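(* (Negative iterated log entropy.) Let $n\in\mathbb N$, let $X:=\mathbb R^n$ with an arbitrary norm $\|\cdot\|$, let $U:=(1,\infty)^n$, and define $b:X\to(-\infty,\infty]$ by $b(x):=-\sum_{k=1}^n\log(\log(x_k))$ for $x\in U$ and $b(x):=\infty$ for $x\notin U$. Then: (a) $b$ is strongly convex on every nonempty, bounded and convex subset $S$ of $U$, with $$\mu[S]:=\frac{c_2^2}{c_\infty M_S\log(c_\infty M_S)}\left(\frac1{c_\infty M_S\log(c_\infty M_S)}+\frac1{c_\infty M_S}\right)$$ as a strong convexity parameter, where $M_S$ is an upper bound on the norms $\|\cdot\|$ of the vectors of $S$ and $c_2,c_\infty>0$ are constants with $c_2\|v\|\le\|v\|_2$ and $\|v\|_\infty\le c_\infty\|v\|$ for all $v\in X$. (b) $b$ is not uniformly convex on $U$. (c) $b$ is a sequentially consistent Bregman function (with zone $U$) which satisfies the limiting difference property, and for all $y\in U$ and $\gamma\in\mathbb R$ the second type level-set $\{x\in\mathrm{dom}(b):B(x,y)\le\gamma\}$ is bounded.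
   Context: $\|v\|_2$ and $\|v\|_\infty$ are the Euclidean and max norms; $\log$ is the natural logarithm. $\mathrm{dom}(b):=\{x\in X:b(x)<\infty\}$. For convex $b$ and nonempty $S\subseteq\mathrm{dom}(b)$, $b$ is uniformly convex on $S$ if there is $\psi:[0,\infty)\to[0,\infty]$ with $\psi(t)>0$ for $t>0$ such that $b(\lambda x+(1-\lambda)y)+\lambda(1-\lambda)\psi(\|x-y\|)\le\lambda b(x)+(1-\lambda)b(y)$ for all $\lambda\in(0,1)$, $x,y\in S$. If $\psi(t)=\frac12\mu t^2$ with $\mu>0$ works, $b$ is strongly convex on $S$ with strong convexity parameter $\mu$. Divergence: $B(x,y):=b(x)-b(y)-\langle b'(y),x-y\rangle$ for $(x,y)\in\mathrm{dom}(b)\times U$, and $B(x,y):=\infty$ otherwise, where $b'$ is the (Gâteaux) derivative. $b$ is a Bregman function with zone $U$ if: (i) $U=\mathrm{Int}(\mathrm{dom}(b))\ne\emptyset$ and $b$ is Gâteaux differentiable in $U$; (ii) $b$ is convex and lower semicontinuous on $X$ and strictly convex on $\mathrm{dom}(b)$; (iii) for each $\gamma\in\mathbb R$ and $x\in\mathrm{dom}(b)$ the set $\{y\in U:B(x,y)\le\gamma\}$ is bounded; (iv) if $x\in\mathrm{dom}(b)$ and $(y_i)$ in $U$ satisfy $\|x-y_i\|\to0$, then $B(x,y_i)\to0$; (v) if $(x_i)$ is a bounded sequence in $\mathrm{dom}(b)$, $(y_i)$ is a sequence in $U$, $B(x_i,y_i)\to0$ and $\|y_i-y\|\to0$ for some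 $y\in\mathrm{dom}(b)$, then $\|x_i-y\|\to0$. $b$ has the limiting difference property if for each $x\in\mathrm{dom}(b)$ and each sequence $(y_i)$ in $U$ converging (weakly) to some $y\in U$, $B(x,y)=\lim_{i\to\infty}(B(x,y_i)-B(y,y_i))$. $b$ is sequentially consistent if for all sequences $(x_i)$ in $\mathrm{dom}(b)$ and $(y_i)$ in $U$ with $(y_i)$ bounded and $B(x_i,y_i)\to0$ one has $\|x_i-y_i\|\to0$. *)

theory Defs
  imports "HOL-Analysis.Analysis"
begin

text \<open>
  The norm \<open>N\<close> is an explicit parameter, because it is arbitrary and the type class norm of
  \<open>real ^ 'n\<close> is the Euclidean one. All topological notions below (interior, boundedness,
  convergence, lower semicontinuity, continuity of functionals) are taken with respect to \<open>N\<close>.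
\<close>

definition is_norm :: "('a::real_vector \<Rightarrow> real) \<Rightarrow> bool" where
  "is_norm N \<longleftrightarrow>
     (\<forall>x. 0 \<le> N x) \<and> (\<forall>x. N x = 0 \<longleftrightarrow> x = 0) \<and>
     (\<forall>a x. N (a *\<^sub>R x) = \<bar>a\<bar> * N x) \<and> (\<forall>x y. N (x + y) \<le> N x + N y)"

abbreviation norm_topology :: "('a::real_vector \<Rightarrow> real) \<Rightarrow> 'a topology" where
  "norm_topology N \<equiv> Metric_space.mtopology UNIV (\<lambda>x y. N (x - y))"

definition norm_bounded :: "('a::real_vector \<Rightarrow> real) \<Rightarrow> 'a set \<Rightarrow> bool" where
  "norm_bounded N S \<longleftrightarrow> (\<exists>C. \<forall>x\<in>S. N x \<le> C)"

definition continuous_functional :: "('a::real_vector \<Rightarrow> real) \<Rightarrow> ('a \<Rightarrow> real) \<Rightarrow> bool" where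
  "continuous_functional N f \<longleftrightarrow> linear f \<and> (\<exists>C. \<forall>v. \<bar>f v\<bar> \<le> C * N v)"

definition norm_converges ::
  "('a::real_vector \<Rightarrow> real) \<Rightarrow> (nat \<Rightarrow> 'a) \<Rightarrow> 'a \<Rightarrow> bool" where
  "norm_converges N y l \<longleftrightarrow> (\<lambda>i. N (y i - l)) \<longlonglongrightarrow> 0"

definition weakly_converges ::
  "('a::real_vector \<Rightarrow> real) \<Rightarrow> (nat \<Rightarrow> 'a) \<Rightarrow> 'a \<Rightarrow> bool" where
  "weakly_converges N y l \<longleftrightarrow>
     (\<forall>f. continuous_functional N f \<longrightarrow> (\<lambda>i. f (y i)) \<longlonglongrightarrow> f l)"

definition effective_domain :: "('a \<Rightarrow> ereal) \<Rightarrow> 'a set" where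
  "effective_domain b = {x. b x < \<infinity>}"

definition ereal_convex :: "('a::real_vector \<Rightarrow> ereal) \<Rightarrow> bool" where
  "ereal_convex b \<longleftrightarrow>
     (\<forall>x y. \<forall>t::real. 0 < t \<longrightarrow> t < 1 \<longrightarrow>
        b (t *\<^sub>R x + (1 - t) *\<^sub>R y) \<le> ereal t * b x + ereal (1 - t) * b y)"

definition ereal_strictly_convex_on :: "'a set \<Rightarrow> ('a::real_vector \<Rightarrow> ereal) \<Rightarrow> bool" where
  "ereal_strictly_convex_on S b \<longleftrightarrow>
     (\<forall>x\<in>S. \<forall>y\<in>S. \<forall>t::real. x \<noteq> y \<longrightarrow> 0 < t \<longrightarrow> t < 1 \<longrightarrow>
        b (t *\<^sub>R x + (1 - t) *\<^sub>R y) < ereal t * b x + ereal (1 - t) * b y)"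

definition lower_semicontinuous :: "('a::real_vector \<Rightarrow> real) \<Rightarrow> ('a \<Rightarrow> ereal) \<Rightarrow> bool" where
  "lower_semicontinuous N b \<longleftrightarrow> (\<forall>c. openin (norm_topology N) {x. c < b x})"

text \<open>
  The standing requirements that \<open>b\<close> be convex and \<open>{} \<noteq> S \<subseteq> effective_domain b\<close> are deliberately
  not part of the following three definitions, so that the negation of uniform convexity
  is about the inequality and nothing else.
\<close>

definition convexity_gauge_on ::
  "('a::real_vector \<Rightarrow> real) \<Rightarrow> 'a set \<Rightarrow> ('a \<Rightarrow> ereal) \<Rightarrow> (real \<Rightarrow> ereal) \<Rightarrow> bool" where
  "convexity_gauge_on N S b \<psi> \<longleftrightarrow>
     (\<forall>x\<in>S. \<forall>y\<in>S. \<forall>t::real. 0 < t \<longrightarrow> t < 1 \<longrightarrow>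
        b (t *\<^sub>R x + (1 - t) *\<^sub>R y) + ereal (t * (1 - t)) * \<psi> (N (x - y))
          \<le> ereal t * b x + ereal (1 - t) * b y)"

definition uniformly_convex_on ::
  "('a::real_vector \<Rightarrow> real) \<Rightarrow> 'a set \<Rightarrow> ('a \<Rightarrow> ereal) \<Rightarrow> bool" where
  "uniformly_convex_on N S b \<longleftrightarrow>
     (\<exists>\<psi>. (\<forall>t\<ge>0. 0 \<le> \<psi> t) \<and> (\<forall>t>0. 0 < \<psi> t) \<and> convexity_gauge_on N S b \<psi>)"

definition strongly_convex_on ::
  "('a::real_vector \<Rightarrow> real) \<Rightarrow> 'a set \<Rightarrow> ('a \<Rightarrow> ereal) \<Rightarrow> real \<Rightarrow> bool" where
  "strongly_convex_on N S b \<mu> \<longleftrightarrow>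
     0 < \<mu> \<and> convexity_gauge_on N S b (\<lambda>t. ereal (1/2 * \<mu> * t\<^sup>2))"

text \<open>
  The extended-real difference quotient is meaningful because this is only used at points
  \<open>y\<close> where \<open>b y\<close> is finite.
\<close>

definition has_gateaux_derivative ::
  "('a::real_vector \<Rightarrow> real) \<Rightarrow> ('a \<Rightarrow> ereal) \<Rightarrow> 'a \<Rightarrow> ('a \<Rightarrow> real) \<Rightarrow> bool" where
  "has_gateaux_derivative N b y L \<longleftrightarrow>
     continuous_functional N L \<and>
     (\<forall>v. ((\<lambda>t::real. (b (y + t *\<^sub>R v) - b y) / ereal t) \<longlongrightarrow> ereal (L v)) (at 0))"

definition gateaux_derivative ::
  "('a::real_vector \<Rightarrow> real) \<Rightarrow> ('a \<Rightarrow> ereal) \<Rightarrow> 'a \<Rightarrow> 'a \<Rightarrow> real" where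
  "gateaux_derivative N b y = (THE L. has_gateaux_derivative N b y L)"

definition bregman_divergence ::
  "('a::real_vector \<Rightarrow> real) \<Rightarrow> ('a \<Rightarrow> ereal) \<Rightarrow> 'a set \<Rightarrow> 'a \<Rightarrow> 'a \<Rightarrow> ereal" where
  "bregman_divergence N b U x y =
     (if x \<in> effective_domain b \<and> y \<in> U
      then b x - b y - ereal (gateaux_derivative N b y (x - y)) else \<infinity>)"

definition bregman_function ::
  "('a::real_vector \<Rightarrow> real) \<Rightarrow> ('a \<Rightarrow> ereal) \<Rightarrow> 'a set \<Rightarrow> bool" where
  "bregman_function N b U \<longleftrightarrow>
     (\<forall>x. b x \<noteq> -\<infinity>) \<and>
     \<comment> \<open>(i)\<close>
     U = norm_topology N interior_of effective_domain b \<and> U \<noteq> {} \<and>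
     (\<forall>y\<in>U. \<exists>L. has_gateaux_derivative N b y L) \<and>
     \<comment> \<open>(ii)\<close>
     ereal_convex b \<and> lower_semicontinuous N b \<and>
     ereal_strictly_convex_on (effective_domain b) b \<and>
     \<comment> \<open>(iii)\<close>
     (\<forall>\<gamma>::real. \<forall>x\<in>effective_domain b.
        norm_bounded N {y\<in>U. bregman_divergence N b U x y \<le> ereal \<gamma>}) \<and>
     \<comment> \<open>(iv)\<close>
     (\<forall>x\<in>effective_domain b. \<forall>y::nat \<Rightarrow> 'a.
        (\<forall>i. y i \<in> U) \<longrightarrow> norm_converges N y x \<longrightarrow>
        (\<lambda>i. bregman_divergence N b U x (y i)) \<longlonglongrightarrow> 0) \<and>
     \<comment> \<open>(v)\<close>
     (\<forall>(x::nat \<Rightarrow> 'a) (y::nat \<Rightarrow> 'a). \<forall>l\<in>effective_domain b.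
        (\<forall>i. x i \<in> effective_domain b) \<longrightarrow> norm_bounded N (range x) \<longrightarrow>
        (\<forall>i. y i \<in> U) \<longrightarrow>
        (\<lambda>i. bregman_divergence N b U (x i) (y i)) \<longlonglongrightarrow> 0 \<longrightarrow>
        norm_converges N y l \<longrightarrow> norm_converges N x l)"

definition limiting_difference_property ::
  "('a::real_vector \<Rightarrow> real) \<Rightarrow> ('a \<Rightarrow> ereal) \<Rightarrow> 'a set \<Rightarrow> bool" where
  "limiting_difference_property N b U \<longleftrightarrow>
     (\<forall>x\<in>effective_domain b. \<forall>y::nat \<Rightarrow> 'a. \<forall>l\<in>U.
        (\<forall>i. y i \<in> U) \<longrightarrow> weakly_converges N y l \<longrightarrow>
        (\<lambda>i. bregman_divergence N b U x (y i) - bregman_divergence N b U l (y i))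
          \<longlonglongrightarrow> bregman_divergence N b U x l)"

definition sequentially_consistent ::
  "('a::real_vector \<Rightarrow> real) \<Rightarrow> ('a \<Rightarrow> ereal) \<Rightarrow> 'a set \<Rightarrow> bool" where
  "sequentially_consistent N b U \<longleftrightarrow>
     (\<forall>(x::nat \<Rightarrow> 'a) (y::nat \<Rightarrow> 'a).
        (\<forall>i. x i \<in> effective_domain b) \<longrightarrow> (\<forall>i. y i \<in> U) \<longrightarrow>
        norm_bounded N (range y) \<longrightarrow>
        (\<lambda>i. bregman_divergence N b U (x i) (y i)) \<longlonglongrightarrow> 0 \<longrightarrow>
        (\<lambda>i. N (x i - y i)) \<longlonglongrightarrow> 0)"

definition loglog_zone :: "(real ^ 'n) set" where
  "loglog_zone = {x. \<forall>k. 1 < x $ k}"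

definition loglog_entropy :: "real ^ 'n \<Rightarrow> ereal" where
  "loglog_entropy x =
     (if x \<in> loglog_zone then ereal (- (\<Sum>k\<in>UNIV. ln (ln (x $ k)))) else \<infinity>)"

end

theory Submission
  imports Defs "HOL-Real_Asymp.Real_Asymp"
begin

text \<open>
  The entropy is a sum over the coordinates of the one-dimensional function
  \<open>g t = - ln (ln t)\<close> on \<open>t > 1\<close>, and its divergence is the corresponding sum of the
  one-dimensional divergences, called \<open>loglog_gap\<close> below. Since all norms on a
  finite-dimensional space are equivalent, every topological notion attached to \<open>N\<close> is the
  Euclidean one, so each claim becomes a statement about \<open>g\<close> in every coordinate.

  The second derivative \<open>g'' t = 1 / (t ln t)\<^sup>2 + 1 / (t\<^sup>2 ln t)\<close> is positive and decreasing.
  Hence \<open>g\<close> is strongly convex on \<open>]1, r]\<close> with parameter \<open>g'' r\<close>. Taking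
  \<open>r = cinf * M\<close>, a bound on all coordinates of vectors in \<open>S\<close>, gives the parameter for \<open>S\<close>
  (\<open>loglog_entropy_strong_convexity_inequality\<close>); applied to just two points it also gives
  strict convexity on the whole zone. On the other hand \<open>g\<close> flattens at infinity: along the
  diagonal the midpoint defect of two points at a fixed distance tends to 0, which rules out
  any gauge on the whole zone.

  Sequential consistency rests on \<open>loglog_gap_bounded_away\<close>. If \<open>t\<close> stays bounded and
  \<open>\<bar>s - t\<bar> \<ge> e\<close>, the divergence of \<open>s\<close> from \<open>t\<close> is at least that of the point at distance
  exactly \<open>e\<close> from \<open>t\<close> towards \<open>s\<close>; this point is again bounded, so strong convexity bounds
  its divergence below by a positive constant. Requirement (v) of a Bregman function follows,
  because a convergent sequence of second arguments is bounded. The level sets of both types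
  are bounded because the gap tends to infinity in either argument: it is nonnegative in
  every coordinate, so no cancellation between coordinates can occur. Requirement (iv) and the
  limiting difference property are the continuity of the divergence in its second argument.
  For lower semicontinuity, exponentiating turns \<open>b x \<le> a\<close> into \<open>(\<Prod>k. ln (x $ k)) \<ge> exp (- a)\<close>,
  a closed condition on \<open>{x. \<forall>k. 1 \<le> x $ k}\<close> that excludes the boundary by itself.
\<close>

section \<open>Norms on finite-dimensional spaces\<close>

text \<open>
  Expanding in the basis bounds \<open>N\<close> above by a multiple of the Euclidean norm. So \<open>N\<close> is
  Lipschitz, attains its minimum on the compact unit sphere, and that minimum is the lower
  constant. The next lemmas transfer each notion defined through \<open>N\<close> to its Euclidean
  counterpart.
\<close>

lemma is_norm_equivalent:
  fixes N :: "'a::euclidean_space \<Rightarrow> real"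
  assumes "is_norm N"
  obtains c C where "0 < c" "0 < C" "\<And>v. c * norm v \<le> N v" "\<And>v. N v \<le> C * norm v"
proof -
  have nonneg: "0 \<le> N v" and zero: "N v = 0 \<longleftrightarrow> v = 0"
    and scale: "N (a *\<^sub>R v) = \<bar>a\<bar> * N v" and triangle: "N (v + w) \<le> N v + N w" for a v w
    using assms by (auto simp: is_norm_def)
  define C where "C = (\<Sum>b\<in>Basis. N b) + 1"
  have "0 < C" using nonneg by (simp add: C_def add_nonneg_pos sum_nonneg)
  have upper: "N v \<le> C * norm v" for v
  proof -
    have sum: "N (sum f A) \<le> (\<Sum>b\<in>A. N (f b))" if "finite A" for f and A :: "'a set"
      using that
    proof induction
      case (insert b A)
      then show ?case using triangle[of "f b" "sum f A"] by simp
    qed (simp add: zero[THEN iffD2, OF refl])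
    have "N v = N (\<Sum>b\<in>Basis. (v \<bullet> b) *\<^sub>R b)" by (simp add: euclidean_representation)
    also have "\<dots> \<le> (\<Sum>b\<in>Basis. \<bar>v \<bullet> b\<bar> * N b)"
      using sum[of Basis "\<lambda>b. (v \<bullet> b) *\<^sub>R b"] by (simp add: scale)
    also have "\<dots> \<le> (\<Sum>b\<in>Basis. norm v * N b)"
      by (intro sum_mono mult_right_mono nonneg Basis_le_norm)
    also have "\<dots> \<le> C * norm v"
      by (simp add: C_def sum_distrib_left algebra_simps)
    finally show ?thesis .
  qed
  have lipschitz: "\<bar>N v - N w\<bar> \<le> C * norm (v - w)" for v w
  proof -
    have "N v \<le> N (v - w) + N w" "N w \<le> N (w - v) + N v"
      using triangle[of "v - w" w] triangle[of "w - v" v] by simp_all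
    with upper[of "v - w"] upper[of "w - v"] show ?thesis
      by (simp add: norm_minus_commute)
  qed
  have "continuous_on (sphere 0 1) N"
    unfolding continuous_on_iff dist_real_def
  proof (intro ballI allI impI)
    fix v and e :: real assume "0 < e"
    show "\<exists>d>0. \<forall>w\<in>sphere 0 1. dist w v < d \<longrightarrow> \<bar>N w - N v\<bar> < e"
    proof (intro exI[of _ "e / C"] conjI ballI impI)
      show "0 < e / C" using \<open>0 < e\<close> \<open>0 < C\<close> by simp
      fix w assume "dist w v < e / C"
      then have "C * norm (w - v) < e" using \<open>0 < C\<close> by (simp add: dist_norm field_simps)
      then show "\<bar>N w - N v\<bar> < e" using lipschitz[of w v] by simp
    qed
  qed
  then obtain v0 where v0: "v0 \<in> sphere 0 1" "\<And>v. v \<in> sphere 0 1 \<Longrightarrow> N v0 \<le> N v"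
    using continuous_attains_inf[of "sphere 0 1" N] by auto
  \<comment> \<open>the minimum on the sphere is positive because its point is not 0\<close>
  have "0 < N v0"
    using v0(1) nonneg[of v0] zero[of v0] by force
  moreover have "N v0 * norm v \<le> N v" for v
  proof (cases "v = 0")
    case False
    then have "N v0 \<le> N ((1 / norm v) *\<^sub>R v)" by (intro v0) simp
    with False show ?thesis by (simp add: scale field_simps)
  qed (simp add: nonneg)
  ultimately show ?thesis using that \<open>0 < C\<close> upper by blast
qed

lemma is_norm_tendsto_zero_iff:
  fixes N :: "'a::euclidean_space \<Rightarrow> real"
  assumes "is_norm N"
  shows "((\<lambda>i. N (z i)) \<longlongrightarrow> 0) F \<longleftrightarrow> (z \<longlongrightarrow> 0) F"
proof -
  obtain c C where N: "0 < c" "0 < C" "\<And>v. c * norm v \<le> N v" "\<And>v. N v \<le> C * norm v"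
    using is_norm_equivalent[OF assms] by metis
  have nonneg: "0 \<le> N v" for v using assms by (simp add: is_norm_def)
  show ?thesis
  proof
    assume "((\<lambda>i. N (z i)) \<longlongrightarrow> 0) F"
    then have "((\<lambda>i. N (z i) / c) \<longlongrightarrow> 0) F" by (rule tendsto_divide_zero)
    then show "(z \<longlongrightarrow> 0) F"
      by (rule Lim_null_comparison[rotated]) (use N in \<open>simp add: field_simps\<close>)
  next
    assume "(z \<longlongrightarrow> 0) F"
    then have "((\<lambda>i. C * norm (z i)) \<longlongrightarrow> 0) F"
      by (auto intro!: tendsto_eq_intros)
    then show "((\<lambda>i. N (z i)) \<longlongrightarrow> 0) F"
      by (rule Lim_null_comparison[rotated]) (use N nonneg in simp)
  qed
qed

lemma norm_converges_iff:
  fixes N :: "'a::euclidean_space \<Rightarrow> real"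
  assumes "is_norm N"
  shows "norm_converges N y l \<longleftrightarrow> y \<longlonglongrightarrow> l"
  unfolding norm_converges_def is_norm_tendsto_zero_iff[OF assms] by (rule LIM_zero_iff)

lemma norm_bounded_iff:
  fixes N :: "'a::euclidean_space \<Rightarrow> real"
  assumes "is_norm N"
  shows "norm_bounded N S \<longleftrightarrow> bounded S"
proof -
  obtain c C where N: "0 < c" "0 < C" "\<And>v. c * norm v \<le> N v" "\<And>v. N v \<le> C * norm v"
    using is_norm_equivalent[OF assms] by metis
  show ?thesis
  proof
    assume "norm_bounded N S"
    then obtain B where "\<And>v. v \<in> S \<Longrightarrow> N v \<le> B" by (auto simp: norm_bounded_def)
    then have "norm v \<le> B / c" if "v \<in> S" for v
      using N(1) order_trans[OF N(3)[of v]] that by (simp add: field_simps)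
    then show "bounded S" by (auto simp: bounded_iff)
  next
    assume "bounded S"
    then obtain B where "\<And>v. v \<in> S \<Longrightarrow> norm v \<le> B" by (auto simp: bounded_iff)
    then have "N v \<le> C * B" if "v \<in> S" for v
      using N(2) order_trans[OF N(4)[of v]] that by simp
    then show "norm_bounded N S" by (auto simp: norm_bounded_def)
  qed
qed

lemma norm_topology_eq_euclidean:
  fixes N :: "'a::euclidean_space \<Rightarrow> real"
  assumes "is_norm N"
  shows "norm_topology N = euclidean"
proof -
  obtain c C where N: "0 < c" "0 < C" "\<And>v. c * norm v \<le> N v" "\<And>v. N v \<le> C * norm v"
    using is_norm_equivalent[OF assms] by metis
  have minus: "N (v - w) = N (w - v)" for v w
  proof -
    have "N ((-1) *\<^sub>R (w - v)) = \<bar>-1\<bar> * N (w - v)"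
      using assms unfolding is_norm_def by blast
    then show ?thesis by simp
  qed
  interpret Metric_space UNIV "\<lambda>v w. N (v - w)"
  proof
    show "N (v - u) \<le> N (v - w) + N (w - u)" for v w u
      using assms unfolding is_norm_def by (metis add_diff_eq diff_add_cancel)
  qed (use assms minus in \<open>auto simp: is_norm_def\<close>)
  have ball: "mball v r = {w. N (w - v) < r}" for v r
    by (auto simp: mball_def minus)
  have "openin mtopology S \<longleftrightarrow> open S" for S
  proof
    assume S: "openin mtopology S"
    show "open S" unfolding open_contains_ball
    proof
      fix v assume "v \<in> S"
      then obtain r where r: "0 < r" "mball v r \<subseteq> S"
        using S by (auto simp: openin_mtopology)
      have "ball v (r / C) \<subseteq> mball v r"
      proof
        fix w assume "w \<in> ball v (r / C)"
        then have "C * norm (w - v) < r"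
          using N(2) by (simp add: dist_norm norm_minus_commute field_simps)
        then show "w \<in> mball v r" using N(4)[of "w - v"] by (simp add: ball)
      qed
      with r N(2) show "\<exists>e>0. ball v e \<subseteq> S" by (intro exI[of _ "r / C"]) auto
    qed
  next
    assume S: "open S"
    show "openin mtopology S" unfolding openin_mtopology
    proof (intro conjI allI impI)
      fix v assume "v \<in> S"
      then obtain r where r: "0 < r" "ball v r \<subseteq> S"
        using S by (auto simp: open_contains_ball)
      have "mball v (c * r) \<subseteq> ball v r"
      proof
        fix w assume "w \<in> mball v (c * r)"
        then have "c * norm (w - v) < c * r"
          using N(3)[of "w - v"] by (simp add: ball)
        then show "w \<in> ball v r"
          using N(1) by (simp add: dist_norm norm_minus_commute)
      qed
      with r N(1) show "\<exists>e>0. mball v e \<subseteq> S" by (intro exI[of _ "c * r"]) auto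
    qed simp
  qed
  then show ?thesis by (simp add: topology_eq)
qed

lemma continuous_functional_iff:
  fixes N :: "'a::euclidean_space \<Rightarrow> real"
  assumes "is_norm N"
  shows "continuous_functional N f \<longleftrightarrow> linear f"
proof
  assume f: "linear f"
  obtain c C where N: "0 < c" "0 < C" "\<And>v. c * norm v \<le> N v" "\<And>v. N v \<le> C * norm v"
    using is_norm_equivalent[OF assms] by metis
  obtain B where B: "0 < B" "\<And>v. norm (f v) \<le> B * norm v"
    using linear_bounded_pos[OF f] by blast
  have "\<bar>f v\<bar> \<le> B / c * N v" for v
  proof -
    have "B * norm v \<le> B * (N v / c)"
      using B(1) N(1) N(3)[of v] by (intro mult_left_mono) (simp_all add: field_simps)
    then show ?thesis using B(2)[of v] by simp
  qed
  with f show "continuous_functional N f"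
    unfolding continuous_functional_def by (intro conjI exI[of _ "B / c"] allI)
qed (simp add: continuous_functional_def)

text \<open>
  The coordinate functionals are linear, hence continuous for \<open>N\<close>, so weak convergence
  already forces convergence in every coordinate.
\<close>

lemma weakly_converges_iff:
  fixes N :: "'a::euclidean_space \<Rightarrow> real"
  assumes "is_norm N"
  shows "weakly_converges N y l \<longleftrightarrow> y \<longlonglongrightarrow> l"
proof
  assume w: "weakly_converges N y l"
  show "y \<longlonglongrightarrow> l"
  proof (subst tendsto_componentwise_iff, intro ballI)
    fix b :: 'a
    have "linear (\<lambda>v. v \<bullet> b)" by (simp add: bounded_linear.linear bounded_linear_inner_left)
    then show "(\<lambda>i. y i \<bullet> b) \<longlonglongrightarrow> l \<bullet> b"
      using w continuous_functional_iff[OF assms] by (auto simp: weakly_converges_def)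
  qed
next
  assume "y \<longlonglongrightarrow> l"
  then show "weakly_converges N y l"
    unfolding weakly_converges_def continuous_functional_iff[OF assms]
    by (auto intro: bounded_linear.tendsto linear_conv_bounded_linear[THEN iffD1])
qed

text \<open>
  The derivative is unique because limits in the extended reals are, so the definite
  description picks out any derivative that has been exhibited.
\<close>

lemma gateaux_derivative_eq:
  assumes L: "has_gateaux_derivative N b y L"
  shows "gateaux_derivative N b y = L"
  unfolding gateaux_derivative_def
proof (rule the_equality[where P = "has_gateaux_derivative N b y", OF L])
  fix L' assume L': "has_gateaux_derivative N b y L'"
  show "L' = L"
  proof
    fix v
    have "ereal (L' v) = ereal (L v)"
      by (rule tendsto_unique[of "at (0::real)" "\<lambda>t. (b (y + t *\<^sub>R v) - b y) / ereal t"])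
         (use L L' in \<open>auto simp: has_gateaux_derivative_def\<close>)
    then show "L' v = L v" by simp
  qed
qed

section \<open>The function \<open>- ln (ln t)\<close> on the half-line \<open>t > 1\<close>\<close>

text \<open>
  The second derivative of \<open>\<lambda>t. - ln (ln t)\<close>, in the factored form in which the strong
  convexity parameter is stated.
\<close>

definition loglog_curvature :: "real \<Rightarrow> real" where
  "loglog_curvature r = 1 / (r * ln r) * (1 / (r * ln r) + 1 / r)"

text \<open>
  The Bregman divergence of \<open>\<lambda>t. - ln (ln t)\<close>.
\<close>

definition loglog_gap :: "real \<Rightarrow> real \<Rightarrow> real" where
  "loglog_gap s t = ln (ln t) - ln (ln s) + (s - t) / (t * ln t)"

lemma has_real_derivative_minus_ln_ln:
  assumes "1 < t"
  shows "((\<lambda>t. - ln (ln t)) has_real_derivative - (1 / (t * ln t))) (at t)"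
  using assms by (auto intro!: derivative_eq_intros simp: field_simps)

lemma has_real_derivative_loglog_slope:
  assumes "1 < t"
  shows "((\<lambda>t. - (1 / (t * ln t))) has_real_derivative loglog_curvature t) (at t)"
  using assms
  by (auto intro!: derivative_eq_intros simp: loglog_curvature_def divide_simps)

lemma loglog_curvature_pos: "1 < r \<Longrightarrow> 0 < loglog_curvature r"
  unfolding loglog_curvature_def by (intro mult_pos_pos add_pos_pos divide_pos_pos) auto

lemma slope_denominator_mono:
  fixes t r :: real
  assumes "1 < t" "t \<le> r"
  shows "t * ln t \<le> r * ln r" "0 < t * ln t"
  using assms by (auto intro!: mult_mono)

lemma loglog_curvature_antimono:
  assumes "1 < t" "t \<le> r"
  shows "loglog_curvature r \<le> loglog_curvature t"
proof -
  note * = slope_denominator_mono[OF assms]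
  have 1: "1 / (r * ln r) \<le> 1 / (t * ln t)" "1 / r \<le> 1 / t"
    using * assms by (auto intro!: divide_left_mono mult_pos_pos)
  show ?thesis
    unfolding loglog_curvature_def
    by (rule mult_mono[OF 1(1) add_mono[OF 1]]) (use assms * in auto)
qed

text \<open>
  The curvature decreases, so on \<open>]1, r]\<close> it is smallest at \<open>r\<close>; subtracting the parabola with
  that curvature leaves a function with nonnegative second derivative. The two quadratic
  lower bounds below, for chords and for tangents, are the chord and tangent inequalities of
  this difference.
\<close>

lemma convex_on_minus_ln_ln_minus_square:
  fixes r :: real
  defines "m \<equiv> loglog_curvature r"
  shows "convex_on {1<..r} (\<lambda>t. - ln (ln t) - m / 2 * t\<^sup>2)"
proof (rule f''_ge0_imp_convex)
  show "convex {1<..r}" by simp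
  fix t assume t: "t \<in> {1<..r}"
  show "((\<lambda>t. - ln (ln t) - m / 2 * t\<^sup>2) has_real_derivative - (1 / (t * ln t)) - m * t) (at t)"
    using has_real_derivative_minus_ln_ln[of t] t
    by (auto intro!: derivative_eq_intros)
  show "((\<lambda>t. - (1 / (t * ln t)) - m * t) has_real_derivative loglog_curvature t - m) (at t)"
    using t by (intro DERIV_diff has_real_derivative_loglog_slope DERIV_cmult_Id) simp
  show "0 \<le> loglog_curvature t - m"
    using loglog_curvature_antimono[of t r] t by (simp add: m_def)
qed

lemma minus_ln_ln_strongly_convex:
  fixes r s t u :: real
  assumes "1 < s" "s \<le> r" "1 < t" "t \<le> r" "0 < u" "u < 1"
  shows "- ln (ln (u * s + (1 - u) * t)) + u * (1 - u) * (loglog_curvature r / 2 * (s - t)\<^sup>2)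
         \<le> u * - ln (ln s) + (1 - u) * - ln (ln t)"
proof -
  define m where "m = loglog_curvature r"
  have "- ln (ln (u * s + (1 - u) * t)) - m / 2 * (u * s + (1 - u) * t)\<^sup>2
      \<le> u * (- ln (ln s) - m / 2 * s\<^sup>2) + (1 - u) * (- ln (ln t) - m / 2 * t\<^sup>2)"
    using convex_onD[OF convex_on_minus_ln_ln_minus_square[of r], of u t s] assms
    by (simp add: m_def add.commute)
  also have "\<dots> = u * - ln (ln s) + (1 - u) * - ln (ln t)
      - u * (1 - u) * (m / 2 * (s - t)\<^sup>2) - m / 2 * (u * s + (1 - u) * t)\<^sup>2"
    by (simp add: power2_eq_square field_simps)
  finally show ?thesis by (simp add: m_def)
qed

lemma loglog_gap_ge_square:
  assumes "1 < s" "s < r" "1 < t" "t < r"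
  shows "loglog_curvature r / 2 * (s - t)\<^sup>2 \<le> loglog_gap s t"
proof -
  define m where "m = loglog_curvature r"
  let ?f = "\<lambda>t. - ln (ln t) - m / 2 * t\<^sup>2"
  have "?f s - ?f t \<ge> (- (1 / (t * ln t)) - m * t) * (s - t)"
  proof (rule convex_on_imp_above_tangent)
    show "convex_on {1<..<r} ?f"
      by (rule convex_on_subset[OF convex_on_minus_ln_ln_minus_square[of r, folded m_def]]) auto
    show "t \<in> interior {1<..<r}" "s \<in> {1<..<r}" "connected {1<..<r}"
      using assms by (auto simp: interior_open)
    show "(?f has_real_derivative - (1 / (t * ln t)) - m * t) (at t within {1<..<r})"
      by (rule DERIV_subset[where s = UNIV])
         (use has_real_derivative_minus_ln_ln[of t] assms in \<open>auto intro!: derivative_eq_intros\<close>)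
  qed
  then show ?thesis
    by (simp add: loglog_gap_def m_def[symmetric] power2_eq_square algebra_simps diff_divide_distrib)
qed

lemma loglog_gap_nonneg:
  assumes "1 < s" "1 < t"
  shows "0 \<le> loglog_gap s t"
proof -
  have "0 \<le> loglog_curvature (s + t) / 2 * (s - t)\<^sup>2"
    using loglog_curvature_pos[of "s + t"] assms by simp
  also have "\<dots> \<le> loglog_gap s t"
    using assms by (intro loglog_gap_ge_square) auto
  finally show ?thesis .
qed

text \<open>
  Three-point identity: the gap from \<open>t\<close> to \<open>s\<close> is the sum of the gaps from \<open>t\<close> to \<open>u\<close> and from
  \<open>u\<close> to \<open>s\<close> plus the change of slope between \<open>t\<close> and \<open>u\<close> times \<open>s - u\<close>. As the slope
  increases, that product is nonnegative when \<open>u\<close> lies between \<open>t\<close> and \<open>s\<close>.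
\<close>

lemma loglog_gap_mono:
  assumes "1 < s" "1 < t" "1 < u" and between: "t \<le> u \<and> u \<le> s \<or> s \<le> u \<and> u \<le> t"
  shows "loglog_gap u t \<le> loglog_gap s t"
proof -
  have "loglog_gap s t =
      loglog_gap s u + loglog_gap u t + (1 / (t * ln t) - 1 / (u * ln u)) * (s - u)"
    using assms by (simp add: loglog_gap_def field_simps)
  moreover have "0 \<le> (1 / (t * ln t) - 1 / (u * ln u)) * (s - u)"
    using between
  proof
    assume *: "t \<le> u \<and> u \<le> s"
    then have "1 / (u * ln u) \<le> 1 / (t * ln t)"
      using slope_denominator_mono[of t u] slope_denominator_mono[of u u] assms
      by (auto intro!: divide_left_mono mult_pos_pos)
    with * show ?thesis by simp
  next
    assume *: "s \<le> u \<and> u \<le> t"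
    then have "1 / (t * ln t) \<le> 1 / (u * ln u)"
      using slope_denominator_mono[of u t] slope_denominator_mono[of t t] assms
      by (auto intro!: divide_left_mono mult_pos_pos)
    with * show ?thesis by (intro mult_nonpos_nonpos) auto
  qed
  ultimately show ?thesis using loglog_gap_nonneg[of s u] assms by linarith
qed

text \<open>
  Only \<open>t\<close> is bounded, so strong convexity cannot be applied to \<open>s\<close> itself. Moving \<open>s\<close> towards
  \<open>t\<close> up to distance exactly \<open>e\<close> can only shrink the gap and ends below \<open>T + e + 1\<close>.
\<close>

lemma loglog_gap_bounded_away:
  fixes T e :: real
  assumes "1 < s" "1 < t" "t \<le> T" "0 < e" "e \<le> \<bar>s - t\<bar>"
  shows "loglog_curvature (T + e + 1) / 2 * e\<^sup>2 \<le> loglog_gap s t"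
proof -
  define u where "u = (if t \<le> s then t + e else t - e)"
  have u: "1 < u" "u < T + e + 1" "t \<le> u \<and> u \<le> s \<or> s \<le> u \<and> u \<le> t" "(u - t)\<^sup>2 = e\<^sup>2"
    using assms by (auto simp: u_def)
  have "loglog_curvature (T + e + 1) / 2 * (u - t)\<^sup>2 \<le> loglog_gap u t"
    using u assms by (intro loglog_gap_ge_square) auto
  also have "\<dots> \<le> loglog_gap s t"
    using u assms by (intro loglog_gap_mono) auto
  finally show ?thesis by (simp add: u(4))
qed

text \<open>
  The term \<open>ln (ln t)\<close> dominates, since \<open>(s - t) / (t * ln t)\<close> tends to 0.
\<close>

lemma loglog_gap_at_top_right:
  assumes "1 < s"
  shows "filterlim (\<lambda>t. loglog_gap s t) at_top at_top"
  unfolding loglog_gap_def by real_asymp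

text \<open>
  The linear term, with positive slope \<open>1 / (t * ln t)\<close>, dominates \<open>ln (ln s)\<close>.
\<close>

lemma loglog_gap_at_top_left:
  assumes "1 < t"
  shows "filterlim (\<lambda>s. loglog_gap s t) at_top at_top"
proof -
  have "filterlim (\<lambda>s. a - ln (ln s) + (s - t) / c) at_top at_top" if "0 < c" for a c :: real
    using that by real_asymp
  from this[of "t * ln t"] show ?thesis
    unfolding loglog_gap_def using assms by simp
qed

lemma tendsto_loglog_gap:
  assumes "1 < s" "1 < l" "(y \<longlongrightarrow> l) F"
  shows "((\<lambda>i. loglog_gap s (y i)) \<longlongrightarrow> loglog_gap s l) F"
  unfolding loglog_gap_def using assms by (auto intro!: tendsto_intros)

text \<open>
  The defect in the midpoint inequality between \<open>s\<close> and \<open>s + 1\<close>; that it vanishes at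
  infinity is what defeats uniform convexity on the whole zone.
\<close>

lemma minus_ln_ln_midpoint_defect_tendsto_0:
  "((\<lambda>s::real. (- ln (ln (s + 1)) - ln (ln s)) / 2 + ln (ln (s + 1 / 2))) \<longlongrightarrow> 0) at_top"
  by real_asymp

section \<open>Convexity, semicontinuity and divergence of the entropy\<close>

lemma loglog_zone_gt_1: "x \<in> loglog_zone \<Longrightarrow> 1 < x $ k"
  by (simp add: loglog_zone_def)

lemma effective_domain_loglog_entropy: "effective_domain loglog_entropy = loglog_zone"
  by (auto simp: effective_domain_def loglog_entropy_def)

lemma open_loglog_zone: "open (loglog_zone :: (real ^ 'n) set)"
proof -
  have "loglog_zone = (\<Inter>k\<in>UNIV. {x :: real ^ 'n. 1 < x $ k})"
    by (auto simp: loglog_zone_def)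
  also have "open \<dots>"
    by (intro open_INT ballI open_Collect_less continuous_intros) auto
  finally show ?thesis .
qed

lemma convex_loglog_zone: "convex (loglog_zone :: (real ^ 'n) set)"
proof -
  have "loglog_zone = (\<Inter>k\<in>UNIV. (\<lambda>x :: real ^ 'n. x $ k) -` {1<..})"
    by (auto simp: loglog_zone_def)
  also have "convex \<dots>"
    by (intro convex_INT convex_linear_vimage)
       (auto intro: bounded_linear.linear bounded_linear_vec_nth)
  finally show ?thesis .
qed

text \<open>
  The squared Euclidean distance is the sum of the squared coordinate distances, so the
  one-dimensional inequality can be summed over the coordinates without loss. The bound \<open>r\<close>
  concerns only the two points, which is what makes the inequality yield strict convexity
  on the unbounded zone as well.
\<close>

lemma loglog_entropy_strong_convexity_inequality:
  fixes x y :: "real ^ 'n"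
  assumes x: "x \<in> loglog_zone" "\<And>k. x $ k \<le> r" and y: "y \<in> loglog_zone" "\<And>k. y $ k \<le> r"
    and u: "0 < u" "u < 1"
  shows "loglog_entropy (u *\<^sub>R x + (1 - u) *\<^sub>R y)
           + ereal (u * (1 - u) * (loglog_curvature r / 2 * (norm (x - y))\<^sup>2))
         \<le> ereal u * loglog_entropy x + ereal (1 - u) * loglog_entropy y"
proof -
  have mid: "u *\<^sub>R x + (1 - u) *\<^sub>R y \<in> loglog_zone"
    using x y u by (intro convexD[OF convex_loglog_zone]) auto
  have "(norm (x - y))\<^sup>2 = (\<Sum>k\<in>UNIV. (x $ k - y $ k)\<^sup>2)"
    unfolding power2_norm_eq_inner inner_vec_def by (simp add: power2_eq_square)
  then have "- (\<Sum>k\<in>UNIV. ln (ln (u * x $ k + (1 - u) * y $ k)))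
        + u * (1 - u) * (loglog_curvature r / 2 * (norm (x - y))\<^sup>2)
      = (\<Sum>k\<in>UNIV. - ln (ln (u * x $ k + (1 - u) * y $ k))
        + u * (1 - u) * (loglog_curvature r / 2 * (x $ k - y $ k)\<^sup>2))"
    by (simp add: sum_distrib_left sum.distrib sum_negf sum_subtractf)
  also have "\<dots> \<le> (\<Sum>k\<in>UNIV. u * - ln (ln (x $ k)) + (1 - u) * - ln (ln (y $ k)))"
    using x y u by (intro sum_mono minus_ln_ln_strongly_convex) (auto simp: loglog_zone_gt_1)
  also have "\<dots> = u * - (\<Sum>k\<in>UNIV. ln (ln (x $ k))) + (1 - u) * - (\<Sum>k\<in>UNIV. ln (ln (y $ k)))"
    by (simp add: sum_distrib_left sum.distrib sum_negf sum_subtractf)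
  finally show ?thesis
    using mid x(1) y(1) by (simp add: loglog_entropy_def)
qed

lemma ereal_strictly_convex_on_loglog_entropy:
  "ereal_strictly_convex_on loglog_zone (loglog_entropy :: real ^ 'n \<Rightarrow> ereal)"
  unfolding ereal_strictly_convex_on_def
proof (intro ballI allI impI)
  fix x y :: "real ^ 'n" and u :: real
  assume xy: "x \<in> loglog_zone" "y \<in> loglog_zone" "x \<noteq> y" and u: "0 < u" "u < 1"
  define r where "r = norm x + norm y + 2"
  have le: "x $ k \<le> r" "y $ k \<le> r" for k
    using component_le_norm_cart[of x k] component_le_norm_cart[of y k] norm_ge_zero[of x]
      norm_ge_zero[of y] unfolding r_def by linarith+
  let ?q = "u * (1 - u) * (loglog_curvature r / 2 * (norm (x - y))\<^sup>2)"
  have "1 < r" using norm_ge_zero[of x] norm_ge_zero[of y] unfolding r_def by linarith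
  then have "0 < ?q" using xy u loglog_curvature_pos[of r] by simp
  have mid: "u *\<^sub>R x + (1 - u) *\<^sub>R y \<in> loglog_zone"
    using xy u by (intro convexD[OF convex_loglog_zone]) auto
  have "loglog_entropy (u *\<^sub>R x + (1 - u) *\<^sub>R y) < loglog_entropy (u *\<^sub>R x + (1 - u) *\<^sub>R y) + ereal ?q"
    using \<open>0 < ?q\<close> mid by (simp add: loglog_entropy_def)
  also have "\<dots> \<le> ereal u * loglog_entropy x + ereal (1 - u) * loglog_entropy y"
    using xy u le by (intro loglog_entropy_strong_convexity_inequality)
  finally show "loglog_entropy (u *\<^sub>R x + (1 - u) *\<^sub>R y)
      < ereal u * loglog_entropy x + ereal (1 - u) * loglog_entropy y" .
qed

lemma ereal_convex_loglog_entropy: "ereal_convex (loglog_entropy :: real ^ 'n \<Rightarrow> ereal)"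
  unfolding ereal_convex_def
proof (intro allI impI)
  fix x y :: "real ^ 'n" and u :: real
  assume u: "0 < u" "u < 1"
  show "loglog_entropy (u *\<^sub>R x + (1 - u) *\<^sub>R y)
      \<le> ereal u * loglog_entropy x + ereal (1 - u) * loglog_entropy y"
  proof (cases "x \<in> loglog_zone \<and> y \<in> loglog_zone")
    case True
    show ?thesis
    proof (cases "x = y")
      case False
      with True u show ?thesis
        using ereal_strictly_convex_on_loglog_entropy unfolding ereal_strictly_convex_on_def
        by (blast intro: less_imp_le)
    next
      case True
      moreover have "u *\<^sub>R y + (1 - u) *\<^sub>R y = y" by (simp flip: scaleR_add_left)
      ultimately show ?thesis by (simp add: loglog_entropy_def u algebra_simps)
    qed
  next
    case False
    then show ?thesis using u by (auto simp: loglog_entropy_def)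
  qed
qed

lemma strongly_convex_on_loglog_entropy:
  fixes N :: "real ^ 'n \<Rightarrow> real"
  assumes N: "is_norm N" and S: "S \<noteq> {}" "S \<subseteq> loglog_zone" "\<And>x. x \<in> S \<Longrightarrow> N x \<le> M"
    and c: "0 < c2" "0 < cinf" "\<And>v. c2 * N v \<le> norm v" "\<And>v. infnorm v \<le> cinf * N v"
  shows "strongly_convex_on N S loglog_entropy (c2\<^sup>2 * loglog_curvature (cinf * M))"
proof -
  define r where "r = cinf * M"
  have le: "x $ k \<le> r" if "x \<in> S" for x k
  proof -
    have "x $ k \<le> infnorm x" using component_le_infnorm_cart[of x k] by simp
    also have "\<dots> \<le> cinf * N x" by (rule c)
    also have "\<dots> \<le> r" using S(3)[OF that] c by (simp add: r_def)
    finally show ?thesis .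
  qed
  obtain x0 where "x0 \<in> S" using S by auto
  then have "1 < r" using le[of x0] S(2) loglog_zone_gt_1[of x0] less_le_trans by blast
  then have pos: "0 < loglog_curvature r" by (rule loglog_curvature_pos)
  have "convexity_gauge_on N S loglog_entropy
      (\<lambda>t. ereal (1 / 2 * (c2\<^sup>2 * loglog_curvature r) * t\<^sup>2))"
    unfolding convexity_gauge_on_def
  proof (intro ballI allI impI)
    fix x y and u :: real
    assume xy: "x \<in> S" "y \<in> S" and u: "0 < u" "u < 1"
    \<comment> \<open>the gauge is a quadratic in \<open>N\<close>; the constant \<open>c2\<close> carries it to the Euclidean norm\<close>
    have "(c2 * N (x - y))\<^sup>2 \<le> (norm (x - y))\<^sup>2"
      using c N by (intro power_mono) (auto simp: is_norm_def)
    then have "u * (1 - u) * (loglog_curvature r / 2 * (c2 * N (x - y))\<^sup>2)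
        \<le> u * (1 - u) * (loglog_curvature r / 2 * (norm (x - y))\<^sup>2)"
      using pos u by (intro mult_left_mono) auto
    then have "ereal (u * (1 - u)) * ereal (1 / 2 * (c2\<^sup>2 * loglog_curvature r) * (N (x - y))\<^sup>2)
        \<le> ereal (u * (1 - u) * (loglog_curvature r / 2 * (norm (x - y))\<^sup>2))"
      by (simp add: power_mult_distrib mult_ac)
    then have "loglog_entropy (u *\<^sub>R x + (1 - u) *\<^sub>R y)
          + ereal (u * (1 - u)) * ereal (1 / 2 * (c2\<^sup>2 * loglog_curvature r) * (N (x - y))\<^sup>2)
        \<le> loglog_entropy (u *\<^sub>R x + (1 - u) *\<^sub>R y)
          + ereal (u * (1 - u) * (loglog_curvature r / 2 * (norm (x - y))\<^sup>2))"
      by (rule add_left_mono)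
    also have "\<dots> \<le> ereal u * loglog_entropy x + ereal (1 - u) * loglog_entropy y"
      using xy S(2) u le by (intro loglog_entropy_strong_convexity_inequality) auto
    finally show "loglog_entropy (u *\<^sub>R x + (1 - u) *\<^sub>R y)
          + ereal (u * (1 - u)) * ereal (1 / 2 * (c2\<^sup>2 * loglog_curvature r) * (N (x - y))\<^sup>2)
        \<le> ereal u * loglog_entropy x + ereal (1 - u) * loglog_entropy y" .
  qed
  with pos c(1) show ?thesis
    by (simp add: strongly_convex_on_def r_def)
qed

text \<open>
  On the diagonal the points with coordinates \<open>s\<close> and \<open>s + 1\<close> have the same distance for every
  \<open>s\<close>, so one value of the gauge would bound all their midpoint defects below.
\<close>

lemma not_uniformly_convex_on_loglog_entropy:
  fixes N :: "real ^ 'n \<Rightarrow> real"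
  assumes N: "is_norm N"
  shows "\<not> uniformly_convex_on N loglog_zone loglog_entropy"
proof
  assume "uniformly_convex_on N loglog_zone loglog_entropy"
  then obtain \<psi> where \<psi>: "\<And>t. 0 < t \<Longrightarrow> 0 < \<psi> t"
    and gauge: "convexity_gauge_on N loglog_zone loglog_entropy \<psi>"
    by (auto simp: uniformly_convex_on_def)
  define v :: "real \<Rightarrow> real ^ 'n" where "v s = (\<chi> k. s)" for s
  have v: "v s \<in> loglog_zone" "loglog_entropy (v s) = ereal (real CARD('n) * - ln (ln s))" if "1 < s" for s
    using that by (simp_all add: v_def loglog_zone_def loglog_entropy_def)
  have "v 1 \<noteq> 0" by (simp add: v_def vec_eq_iff)
  then have "0 < N (v 1)" using N unfolding is_norm_def by (metis less_eq_real_def)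
  \<comment> \<open>\<open>\<psi>\<close> may be infinite here, so pass to a positive real lower bound\<close>
  from \<psi>[OF this] obtain e where e: "0 < e" "ereal e \<le> \<psi> (N (v 1))"
    using ereal_dense2 by (metis ereal_less(2) less_imp_le)
  have "e / 4 \<le> real CARD('n) * ((- ln (ln (s + 1)) - ln (ln s)) / 2 + ln (ln (s + 1 / 2)))"
    if s: "1 < s" for s :: real
  proof -
    have "(1 / 2) *\<^sub>R v (s + 1) + (1 - 1 / 2) *\<^sub>R v s = v (s + 1 / 2)" "v (s + 1) - v s = v 1"
      by (simp_all add: v_def vec_eq_iff field_simps)
    with gauge[unfolded convexity_gauge_on_def, rule_format, of "v (s + 1)" "v s" "1 / 2"] s
    have "ereal (real CARD('n) * - ln (ln (s + 1 / 2))) + ereal (1 / 2 * (1 - 1 / 2)) * \<psi> (N (v 1))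
        \<le> ereal (1 / 2) * ereal (real CARD('n) * - ln (ln (s + 1)))
          + ereal (1 - 1 / 2) * ereal (real CARD('n) * - ln (ln s))"
      by (simp only: v)
    moreover have "ereal (1 / 2 * (1 - 1 / 2)) * ereal e \<le> ereal (1 / 2 * (1 - 1 / 2)) * \<psi> (N (v 1))"
      using e(2) by (rule ereal_mult_left_mono) simp
    ultimately have "ereal (real CARD('n) * - ln (ln (s + 1 / 2))) + ereal (1 / 2 * (1 - 1 / 2)) * ereal e
        \<le> ereal (1 / 2) * ereal (real CARD('n) * - ln (ln (s + 1)))
          + ereal (1 - 1 / 2) * ereal (real CARD('n) * - ln (ln s))"
      by (meson add_left_mono order_trans)
    then show ?thesis by (simp add: field_simps)
  qed
  then have "\<forall>\<^sub>F s in at_top. e / 4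
      \<le> real CARD('n) * ((- ln (ln (s + 1)) - ln (ln s)) / 2 + ln (ln (s + 1 / 2)))"
    by (intro eventually_mono[OF eventually_gt_at_top[of 1]])
  moreover have "((\<lambda>s. real CARD('n) * ((- ln (ln (s + 1)) - ln (ln s)) / 2 + ln (ln (s + 1 / 2))))
      \<longlongrightarrow> 0) at_top"
    using tendsto_mult_right_zero[OF minus_ln_ln_midpoint_defect_tendsto_0] .
  ultimately have "e / 4 \<le> 0"
    by (intro tendsto_lowerbound) auto
  with e(1) show False by simp
qed

text \<open>
  The sublevel set at a real height \<open>a\<close> is described by a continuous inequality on the closed
  set where all coordinates are at least 1. A point there outside the zone has a coordinate
  equal to 1, so its product of logarithms is 0 and it fails the inequality.
\<close>

lemma lower_semicontinuous_loglog_entropy: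
  fixes N :: "real ^ 'n \<Rightarrow> real"
  assumes "is_norm N"
  shows "lower_semicontinuous N loglog_entropy"
  unfolding lower_semicontinuous_def norm_topology_eq_euclidean[OF assms] open_openin[symmetric]
proof
  fix c :: ereal
  show "open {x :: real ^ 'n. c < loglog_entropy x}"
  proof (cases c)
    case PInf
    then show ?thesis by simp
  next
    case MInf
    then have "{x :: real ^ 'n. c < loglog_entropy x} = UNIV" by (auto simp: loglog_entropy_def)
    then show ?thesis by simp
  next
    case (real a)
    let ?A = "{x :: real ^ 'n. \<forall>k. 1 \<le> x $ k}"
    let ?p = "\<lambda>x :: real ^ 'n. \<Prod>k\<in>UNIV. ln (x $ k)"
    have "?A = (\<Inter>k\<in>UNIV. {x. 1 \<le> x $ k})" by auto
    also have "closed \<dots>"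
      by (intro closed_INT ballI closed_Collect_le continuous_intros)
    finally have "closed ?A" .
    moreover have "continuous_on ?A ?p"
      by (intro continuous_intros) (auto, metis not_one_le_zero)
    ultimately have "closed (?A \<inter> ?p -` {exp (- a)..})"
      by (intro continuous_closed_preimage) auto
    moreover have "{x. c < loglog_entropy x} = - (?A \<inter> ?p -` {exp (- a)..})"
    proof -
      have "loglog_entropy x \<le> ereal a \<longleftrightarrow> x \<in> ?A \<inter> ?p -` {exp (- a)..}" for x :: "real ^ 'n"
      proof (cases "x \<in> loglog_zone")
        case True
        then have "?p x = exp (\<Sum>k\<in>UNIV. ln (ln (x $ k)))"
          by (simp add: exp_sum loglog_zone_gt_1 ln_gt_zero)
        moreover have "x \<in> ?A" using True by (auto simp: loglog_zone_def intro: less_imp_le)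
        ultimately show ?thesis using True by (auto simp: loglog_entropy_def)
      next
        case False
        have "?p x = 0" if "x \<in> ?A"
        proof -
          obtain k where "\<not> 1 < x $ k" using False by (auto simp: loglog_zone_def)
          then have "ln (x $ k) = 0" using that by (metis (mono_tags) ln_one mem_Collect_eq not_less_iff_gr_or_eq order_less_le)
          then show ?thesis by (auto intro!: prod_zero)
        qed
        then have "x \<notin> ?A \<inter> ?p -` {exp (- a)..}"
          using exp_gt_zero[of "- a"] by (metis IntE atLeast_iff not_le vimage_eq)
        then show ?thesis using False by (simp add: loglog_entropy_def)
      qed
      then show ?thesis unfolding real by (auto simp: not_le[symmetric])
    qed
    ultimately show ?thesis by (simp add: open_closed)
  qed
qed

text \<open>
  The zone is open, so for small \<open>t\<close> the extended-real difference quotient is that of a finite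
  sum of real functions of \<open>t\<close>.
\<close>

lemma has_gateaux_derivative_loglog_entropy:
  fixes N :: "real ^ 'n \<Rightarrow> real"
  assumes N: "is_norm N" and y: "y \<in> loglog_zone"
  shows "has_gateaux_derivative N loglog_entropy y
           (\<lambda>v. \<Sum>k\<in>UNIV. - (1 / (y $ k * ln (y $ k))) * v $ k)"
  unfolding has_gateaux_derivative_def continuous_functional_iff[OF N]
proof (intro conjI allI)
  show "linear (\<lambda>v. \<Sum>k\<in>UNIV. - (1 / (y $ k * ln (y $ k))) * v $ k)"
    by (intro linearI)
       (simp_all add: sum_distrib_left sum.distrib[symmetric] algebra_simps add_divide_distrib)
  fix v :: "real ^ 'n"
  define f where "f t = (\<Sum>k\<in>UNIV. - ln (ln (y $ k + t * v $ k)))" for t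
  have "(f has_real_derivative (\<Sum>k\<in>UNIV. - (1 / (y $ k * ln (y $ k))) * v $ k)) (at 0)"
    unfolding f_def
  proof (rule DERIV_sum)
    fix k
    have "((\<lambda>t. y $ k + t * v $ k) has_real_derivative v $ k) (at 0)"
      by (auto intro!: derivative_eq_intros)
    then show "((\<lambda>t. - ln (ln (y $ k + t * v $ k))) has_real_derivative
        - (1 / (y $ k * ln (y $ k))) * v $ k) (at 0)"
      using has_real_derivative_minus_ln_ln[OF loglog_zone_gt_1[OF y, of k]]
      by (intro DERIV_chain2[where f = "\<lambda>s. - ln (ln s)"]) simp_all
  qed
  then have "((\<lambda>t. ereal ((f t - f 0) / t)) \<longlongrightarrow> ereal (\<Sum>k\<in>UNIV. - (1 / (y $ k * ln (y $ k))) * v $ k)) (at 0)"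
    by (simp add: DERIV_def)
  moreover have "\<forall>\<^sub>F t in at 0. ereal ((f t - f 0) / t)
      = (loglog_entropy (y + t *\<^sub>R v) - loglog_entropy y) / ereal t"
  proof -
    have "((\<lambda>t. y + t *\<^sub>R v) \<longlongrightarrow> y) (at 0)" by (auto intro!: tendsto_eq_intros)
    then have "\<forall>\<^sub>F t in at 0. y + t *\<^sub>R v \<in> loglog_zone"
      using topological_tendstoD open_loglog_zone y by blast
    moreover have "\<forall>\<^sub>F t in at (0 :: real). t \<noteq> 0" by (simp add: eventually_at_filter)
    ultimately show ?thesis
    proof eventually_elim
      case (elim t)
      then show ?case using y by (simp add: loglog_entropy_def f_def sum_negf)
    qed
  qed
  ultimately show "((\<lambda>t. (loglog_entropy (y + t *\<^sub>R v) - loglog_entropy y) / ereal t)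
      \<longlongrightarrow> ereal (\<Sum>k\<in>UNIV. - (1 / (y $ k * ln (y $ k))) * v $ k)) (at 0)"
    by (rule Lim_transform_eventually)
qed

lemma bregman_divergence_loglog_entropy:
  fixes N :: "real ^ 'n \<Rightarrow> real"
  assumes "is_norm N" "x \<in> loglog_zone" "y \<in> loglog_zone"
  shows "bregman_divergence N loglog_entropy loglog_zone x y
         = ereal (\<Sum>k\<in>UNIV. loglog_gap (x $ k) (y $ k))"
proof -
  have "(\<Sum>k\<in>UNIV. loglog_gap (x $ k) (y $ k))
      = - (\<Sum>k\<in>UNIV. ln (ln (x $ k))) - - (\<Sum>k\<in>UNIV. ln (ln (y $ k)))
        - (\<Sum>k\<in>UNIV. - (1 / (y $ k * ln (y $ k))) * (x - y) $ k)"
    by (simp add: loglog_gap_def sum.distrib sum_subtractf sum_negf)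
  then show ?thesis
    using assms
    by (simp add: bregman_divergence_def effective_domain_loglog_entropy loglog_entropy_def
        gateaux_derivative_eq[OF has_gateaux_derivative_loglog_entropy])
qed

text \<open>
  All summands are nonnegative, so a bound on the divergence bounds the gap in each
  coordinate.
\<close>

lemma loglog_gap_le_sum:
  assumes "x \<in> loglog_zone" "y \<in> loglog_zone"
  shows "loglog_gap (x $ j) (y $ j) \<le> (\<Sum>k\<in>UNIV. loglog_gap (x $ k) (y $ k))"
  using assms by (intro member_le_sum) (auto simp: loglog_zone_gt_1 loglog_gap_nonneg)

text \<open>
  The zone bounds the coordinates below, so upper bounds suffice.
\<close>

lemma bounded_subset_loglog_zone:
  fixes S :: "(real ^ 'n) set"
  assumes "S \<subseteq> loglog_zone" "\<And>k. \<exists>T. \<forall>y\<in>S. y $ k \<le> T"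
  shows "bounded S"
proof -
  obtain T where T: "\<And>y k. y \<in> S \<Longrightarrow> y $ k \<le> T k" using assms(2) by metis
  have "norm y \<le> (\<Sum>k\<in>UNIV. T k)" if "y \<in> S" for y
  proof -
    have "\<bar>y $ k\<bar> \<le> T k" for k
      using T[OF that, of k] loglog_zone_gt_1[of y k] assms(1) that by auto
    then show ?thesis by (intro order_trans[OF norm_le_l1_cart] sum_mono)
  qed
  then show ?thesis by (auto simp: bounded_iff)
qed

lemma filterlim_at_top_sublevel_bounded:
  fixes f :: "real \<Rightarrow> real"
  assumes "filterlim f at_top at_top"
  shows "\<exists>T. \<forall>t. f t \<le> c \<longrightarrow> t \<le> T"
proof -
  have "\<forall>\<^sub>F t in at_top. c < f t" using assms by (simp add: filterlim_at_top_dense)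
  then obtain T where "\<And>t. T \<le> t \<Longrightarrow> c < f t" by (auto simp: eventually_at_top_linorder)
  then have "\<forall>t. f t \<le> c \<longrightarrow> t \<le> T" by (metis linorder_le_cases not_less)
  then show ?thesis ..
qed

lemma bounded_bregman_right_level_set:
  fixes N :: "real ^ 'n \<Rightarrow> real"
  assumes N: "is_norm N" and x: "x \<in> loglog_zone"
  shows "bounded {y \<in> loglog_zone. bregman_divergence N loglog_entropy loglog_zone x y \<le> ereal c}"
proof (rule bounded_subset_loglog_zone)
  fix k
  obtain T where "\<And>t. loglog_gap (x $ k) t \<le> c \<Longrightarrow> t \<le> T"
    using filterlim_at_top_sublevel_bounded[OF loglog_gap_at_top_right] loglog_zone_gt_1[OF x] by metis
  then have "y $ k \<le> T"
    if "y \<in> loglog_zone" "bregman_divergence N loglog_entropy loglog_zone x y \<le> ereal c" for y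
    using order_trans[OF loglog_gap_le_sum[OF x that(1)]] that(2)
    by (simp add: bregman_divergence_loglog_entropy[OF N x that(1)])
  then show "\<exists>T. \<forall>y\<in>{y \<in> loglog_zone. bregman_divergence N loglog_entropy loglog_zone x y \<le> ereal c}. y $ k \<le> T"
    by blast
qed auto

lemma bounded_bregman_left_level_set:
  fixes N :: "real ^ 'n \<Rightarrow> real"
  assumes N: "is_norm N" and y: "y \<in> loglog_zone"
  shows "bounded {x \<in> loglog_zone. bregman_divergence N loglog_entropy loglog_zone x y \<le> ereal c}"
proof (rule bounded_subset_loglog_zone)
  fix k
  obtain T where "\<And>s. loglog_gap s (y $ k) \<le> c \<Longrightarrow> s \<le> T"
    using filterlim_at_top_sublevel_bounded[OF loglog_gap_at_top_left] loglog_zone_gt_1[OF y] by metis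
  then have "x $ k \<le> T"
    if "x \<in> loglog_zone" "bregman_divergence N loglog_entropy loglog_zone x y \<le> ereal c" for x
    using order_trans[OF loglog_gap_le_sum[OF that(1) y]] that(2)
    by (simp add: bregman_divergence_loglog_entropy[OF N that(1) y])
  then show "\<exists>T. \<forall>x\<in>{x \<in> loglog_zone. bregman_divergence N loglog_entropy loglog_zone x y \<le> ereal c}. x $ k \<le> T"
    by blast
qed auto

lemma tendsto_bregman_divergence_loglog_entropy:
  fixes N :: "real ^ 'n \<Rightarrow> real"
  assumes N: "is_norm N" and x: "x \<in> loglog_zone" and l: "l \<in> loglog_zone"
    and y: "\<And>i. y i \<in> loglog_zone" "y \<longlonglongrightarrow> l"
  shows "(\<lambda>i. bregman_divergence N loglog_entropy loglog_zone x (y i))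
           \<longlonglongrightarrow> bregman_divergence N loglog_entropy loglog_zone x l"
  unfolding bregman_divergence_loglog_entropy[OF N x y(1)] bregman_divergence_loglog_entropy[OF N x l]
  using x l y by (intro tendsto_ereal tendsto_sum tendsto_loglog_gap tendsto_vec_nth)
                 (auto simp: loglog_zone_gt_1)

lemma bregman_divergence_loglog_entropy_self:
  fixes N :: "real ^ 'n \<Rightarrow> real"
  assumes "is_norm N" "x \<in> loglog_zone"
  shows "bregman_divergence N loglog_entropy loglog_zone x x = 0"
  using assms by (simp add: bregman_divergence_loglog_entropy loglog_gap_def zero_ereal_def)

lemma sequentially_consistent_loglog_entropy:
  fixes N :: "real ^ 'n \<Rightarrow> real"
  assumes N: "is_norm N"
  shows "sequentially_consistent N loglog_entropy loglog_zone"
  unfolding sequentially_consistent_def effective_domain_loglog_entropy norm_bounded_iff[OF N]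
    is_norm_tendsto_zero_iff[OF N]
proof (intro allI impI)
  fix x y :: "nat \<Rightarrow> real ^ 'n"
  assume x: "\<forall>i. x i \<in> loglog_zone" and y: "\<forall>i. y i \<in> loglog_zone" and "bounded (range y)"
    and lim: "(\<lambda>i. bregman_divergence N loglog_entropy loglog_zone (x i) (y i)) \<longlonglongrightarrow> 0"
  then obtain T where T: "\<And>i. norm (y i) \<le> T" by (auto simp: bounded_iff)
  have lim': "(\<lambda>i. \<Sum>k\<in>UNIV. loglog_gap (x i $ k) (y i $ k)) \<longlonglongrightarrow> 0"
    using lim x y by (simp add: bregman_divergence_loglog_entropy[OF N] zero_ereal_def)
  show "(\<lambda>i. x i - y i) \<longlonglongrightarrow> 0"
  proof (rule vec_tendstoI)
    fix k
    show "(\<lambda>i. (x i - y i) $ k) \<longlonglongrightarrow> 0 $ k"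
    proof (rule tendstoI)
      fix e :: real assume "0 < e"
      define d where "d = loglog_curvature (T + e + 1) / 2 * e\<^sup>2"
      have "0 \<le> T" using T[of 0] norm_ge_zero order_trans by blast
      then have "0 < d" using \<open>0 < e\<close> loglog_curvature_pos[of "T + e + 1"] by (simp add: d_def)
      with lim' have "\<forall>\<^sub>F i in sequentially. (\<Sum>k\<in>UNIV. loglog_gap (x i $ k) (y i $ k)) < d"
        by (rule order_tendstoD)
      then show "\<forall>\<^sub>F i in sequentially. dist ((x i - y i) $ k) (0 $ k) < e"
      proof eventually_elim
        case (elim i)
        have "y i $ k \<le> T"
          using component_le_norm_cart[of "y i" k] T[of i] by linarith
        then have "d \<le> loglog_gap (x i $ k) (y i $ k)" if "e \<le> \<bar>x i $ k - y i $ k\<bar>"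
          using that x y \<open>0 < e\<close> unfolding d_def
          by (intro loglog_gap_bounded_away) (auto simp: loglog_zone_gt_1)
        moreover have "loglog_gap (x i $ k) (y i $ k) < d"
          using loglog_gap_le_sum[of "x i" "y i" k] x y elim by auto
        ultimately show ?case by (fastforce simp: dist_real_def not_le[symmetric])
      qed
    qed
  qed
qed

text \<open>
  Both divergences converge, and the limit of the subtracted one is \<open>B(l, l) = 0\<close>.
\<close>

lemma limiting_difference_property_loglog_entropy:
  fixes N :: "real ^ 'n \<Rightarrow> real"
  assumes N: "is_norm N"
  shows "limiting_difference_property N loglog_entropy loglog_zone"
  unfolding limiting_difference_property_def effective_domain_loglog_entropy
    weakly_converges_iff[OF N]
proof (intro ballI allI impI)
  fix x l :: "real ^ 'n" and y :: "nat \<Rightarrow> real ^ 'n"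
  let ?B = "bregman_divergence N loglog_entropy loglog_zone"
  assume x: "x \<in> loglog_zone" and l: "l \<in> loglog_zone"
    and "\<forall>i. y i \<in> loglog_zone" "y \<longlonglongrightarrow> l"
  then have y: "\<And>i. y i \<in> loglog_zone" "y \<longlonglongrightarrow> l" by auto
  have "(\<lambda>i. ?B x (y i) - ?B l (y i)) \<longlonglongrightarrow> ?B x l - ?B l l"
    using x l y
    by (intro tendsto_diff_ereal_general tendsto_bregman_divergence_loglog_entropy[OF N])
       (auto simp: bregman_divergence_loglog_entropy[OF N])
  then show "(\<lambda>i. ?B x (y i) - ?B l (y i)) \<longlonglongrightarrow> ?B x l"
    by (simp add: bregman_divergence_loglog_entropy_self[OF N l])
qed

lemma bregman_function_loglog_entropy:
  fixes N :: "real ^ 'n \<Rightarrow> real"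
  assumes N: "is_norm N"
  shows "bregman_function N loglog_entropy loglog_zone"
  unfolding bregman_function_def effective_domain_loglog_entropy
    norm_topology_eq_euclidean[OF N] norm_converges_iff[OF N] norm_bounded_iff[OF N]
proof (intro conjI ballI allI impI)
  show "loglog_entropy x \<noteq> - \<infinity>" for x :: "real ^ 'n"
    by (simp add: loglog_entropy_def)
  show "loglog_zone = euclidean interior_of (loglog_zone :: (real ^ 'n) set)"
    by (simp add: interior_open open_loglog_zone)
  have "(\<chi> k. 2) \<in> (loglog_zone :: (real ^ 'n) set)" by (simp add: loglog_zone_def)
  then show "loglog_zone \<noteq> ({} :: (real ^ 'n) set)" by blast
  show "\<exists>L. has_gateaux_derivative N loglog_entropy y L" if "y \<in> loglog_zone" for y :: "real ^ 'n"
    using has_gateaux_derivative_loglog_entropy[OF N that] by blast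
  show "lower_semicontinuous N loglog_entropy"
    by (rule lower_semicontinuous_loglog_entropy[OF N])
  show "(\<lambda>i. bregman_divergence N loglog_entropy loglog_zone x (y i)) \<longlonglongrightarrow> 0"
    if "x \<in> loglog_zone" "\<forall>i. y i \<in> loglog_zone" "y \<longlonglongrightarrow> x" for x and y :: "nat \<Rightarrow> real ^ 'n"
    using tendsto_bregman_divergence_loglog_entropy[OF N, of x x y] that
    by (simp add: bregman_divergence_loglog_entropy_self[OF N])
  show "x \<longlonglongrightarrow> l"
    if "\<forall>i. x i \<in> loglog_zone" "\<forall>i. y i \<in> loglog_zone" "y \<longlonglongrightarrow> l"
      "(\<lambda>i. bregman_divergence N loglog_entropy loglog_zone (x i) (y i)) \<longlonglongrightarrow> 0"
    for x y :: "nat \<Rightarrow> real ^ 'n" and l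
  proof -
    have "(\<lambda>i. x i - y i) \<longlonglongrightarrow> 0"
      using sequentially_consistent_loglog_entropy[OF N] convergent_imp_bounded[OF that(3)] that
      by (simp add: sequentially_consistent_def effective_domain_loglog_entropy
          norm_bounded_iff[OF N] is_norm_tendsto_zero_iff[OF N])
    from tendsto_add[OF this that(3)] show ?thesis by simp
  qed
qed (use bounded_bregman_right_level_set[OF N] in
    \<open>simp_all add: ereal_convex_loglog_entropy ereal_strictly_convex_on_loglog_entropy\<close>)

theorem mainTheorem9:
  fixes N :: "real ^ 'n \<Rightarrow> real"
  assumes "is_norm N"
  shows
    "(\<forall>S M c2 cinf.
        S \<noteq> {} \<longrightarrow> norm_bounded N S \<longrightarrow> convex S \<longrightarrow> S \<subseteq> loglog_zone \<longrightarrow>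
        (\<forall>x\<in>S. N x \<le> M) \<longrightarrow>
        0 < c2 \<longrightarrow> 0 < cinf \<longrightarrow>
        (\<forall>v. c2 * N v \<le> norm v) \<longrightarrow> (\<forall>v. infnorm v \<le> cinf * N v) \<longrightarrow>
        strongly_convex_on N S loglog_entropy
          (c2\<^sup>2 / (cinf * M * ln (cinf * M)) *
             (1 / (cinf * M * ln (cinf * M)) + 1 / (cinf * M))))
     \<and> \<not> uniformly_convex_on N loglog_zone loglog_entropy
     \<and> bregman_function N loglog_entropy loglog_zone
     \<and> sequentially_consistent N loglog_entropy loglog_zone
     \<and> limiting_difference_property N loglog_entropy loglog_zone
     \<and> (\<forall>y\<in>loglog_zone. \<forall>\<gamma>::real.
          norm_bounded N {x \<in> effective_domain loglog_entropy.
            bregman_divergence N loglog_entropy loglog_zone x y \<le> ereal \<gamma>})"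
proof (intro conjI allI impI ballI)
  fix S :: "(real ^ 'n) set" and M c2 cinf :: real
  assume "S \<noteq> {}" "S \<subseteq> loglog_zone" "\<forall>x\<in>S. N x \<le> M" "0 < c2" "0 < cinf"
    "\<forall>v. c2 * N v \<le> norm v" "\<forall>v. infnorm v \<le> cinf * N v"
  then have "strongly_convex_on N S loglog_entropy (c2\<^sup>2 * loglog_curvature (cinf * M))"
    using assms by (intro strongly_convex_on_loglog_entropy) auto
  then show "strongly_convex_on N S loglog_entropy
          (c2\<^sup>2 / (cinf * M * ln (cinf * M)) *
             (1 / (cinf * M * ln (cinf * M)) + 1 / (cinf * M)))"
    by (simp add: loglog_curvature_def)
next
  fix y :: "real ^ 'n" and \<gamma> :: real
  assume "y \<in> loglog_zone"
  then show "norm_bounded N {x \<in> effective_domain loglog_entropy.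
            bregman_divergence N loglog_entropy loglog_zone x y \<le> ereal \<gamma>}"
    using bounded_bregman_left_level_set[OF assms]
    by (simp add: norm_bounded_iff[OF assms] effective_domain_loglog_entropy)
qed (intro not_uniformly_convex_on_loglog_entropy bregman_function_loglog_entropy
    sequentially_consistent_loglog_entropy limiting_difference_property_loglog_entropy assms)+

end
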